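(* Let $n\in\mathbb{N}$ be given. There are infinitely many everywhere defined non-closable unbounded operators $T$ such that $T^n=0$ everywhere on $H$ while $T^{n-1}\neq 0$.
   Context: $H$ denotes a (complex) Hilbert space, and operators are linear. An operator $T$ with domain $D(T)\subset H$ is everywhere defined if $D(T)=H$. It is closable if, for every sequence $(x_k)$ in $D(T)$ with $x_k\to 0$ and $Tx_k\to y$, one has $y=0$; otherwise it is non-closable (unclosable). Powers of $T$ are taken on their natural domains.
   Formalization: The claim is stated for n ≥ 2 and infinite-dimensional H: for n = 1, T = 0 is bounded and closable; for n = 0, T^{n-1} is undefined; on a finite-dimensional H every everywhere defined operator is bounded. *)

theory Defs
  imports "HOL-Analysis.Analysis"
begin

text \<open>Complex inner product spaces; the inner product is linear in its first argument.
  Positive definiteness is contained in the norm axiom of the class, because the norm is a norm.\<close>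

class complex_inner = real_normed_vector +
  fixes scaleC :: "complex \<Rightarrow> 'a \<Rightarrow> 'a" (infixr "*\<^sub>C" 75)
    and cinner :: "'a \<Rightarrow> 'a \<Rightarrow> complex"
  assumes scaleC_add_right: "a *\<^sub>C (x + y) = a *\<^sub>C x + a *\<^sub>C y"
    and scaleC_add_left: "(a + b) *\<^sub>C x = a *\<^sub>C x + b *\<^sub>C x"
    and scaleC_scaleC: "a *\<^sub>C (b *\<^sub>C x) = (a * b) *\<^sub>C x"
    and scaleC_one: "1 *\<^sub>C x = x"
    and scaleR_scaleC: "r *\<^sub>R x = complex_of_real r *\<^sub>C x"
    and cinner_commute: "cinner x y = cnj (cinner y x)"
    and cinner_add_left: "cinner (x + y) z = cinner x z + cinner y z"
    and cinner_scaleC_left: "cinner (a *\<^sub>C x) y = a * cinner x y"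
    and cinner_norm: "cinner x x = complex_of_real ((norm x)\<^sup>2)"

class chilbert_space = complex_inner + complete_space

global_interpretation complex_vector:
  vector_space "scaleC :: complex \<Rightarrow> 'a \<Rightarrow> 'a::complex_inner"
  by unfold_locales
    (simp_all add: scaleC_add_right scaleC_add_left scaleC_scaleC scaleC_one)

definition infinite_dimensional :: "'a::complex_inner itself \<Rightarrow> bool" where
  "infinite_dimensional _ \<longleftrightarrow>
     \<not> (\<exists>B :: 'a set. finite B \<and> complex_vector.span B = UNIV)"

text \<open>An operator is a partial map whose domain of definedness is \<open>D(T)\<close>.
  Composition of partial maps then yields products on their natural domains:
  \<open>x\<close> lies in the domain of \<open>S \<circ>\<^sub>m T\<close> iff \<open>x \<in> D(T)\<close> and \<open>T x \<in> D(S)\<close>.\<close>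

definition linear_operator :: "('a::complex_inner \<rightharpoonup> 'a) \<Rightarrow> bool" where
  "linear_operator T \<longleftrightarrow>
     complex_vector.subspace (dom T) \<and>
     (\<forall>x\<in>dom T. \<forall>y\<in>dom T. the (T (x + y)) = the (T x) + the (T y)) \<and>
     (\<forall>c. \<forall>x\<in>dom T. the (T (c *\<^sub>C x)) = c *\<^sub>C the (T x))"

definition everywhere_defined :: "('a \<rightharpoonup> 'a) \<Rightarrow> bool" where
  "everywhere_defined T \<longleftrightarrow> dom T = UNIV"

definition bounded_operator :: "('a::complex_inner \<rightharpoonup> 'a) \<Rightarrow> bool" where
  "bounded_operator T \<longleftrightarrow> (\<exists>M. \<forall>x\<in>dom T. norm (the (T x)) \<le> M * norm x)"

definition closable :: "('a::complex_inner \<rightharpoonup> 'a) \<Rightarrow> bool" where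
  "closable T \<longleftrightarrow>
     (\<forall>(X :: nat \<Rightarrow> 'a) y.
        (\<forall>k. X k \<in> dom T) \<longrightarrow> X \<longlonglongrightarrow> 0 \<longrightarrow> (\<lambda>k. the (T (X k))) \<longlonglongrightarrow> y \<longrightarrow> y = 0)"

fun operator_power :: "('a \<rightharpoonup> 'a) \<Rightarrow> nat \<Rightarrow> ('a \<rightharpoonup> 'a)" where
  "operator_power T 0 = Some"
| "operator_power T (Suc k) = T \<circ>\<^sub>m operator_power T k"

text \<open>The zero operator on all of \<open>H\<close>, so \<open>T\<^sup>n = 0\<close> includes \<open>D(T\<^sup>n) = H\<close>.\<close>

definition zero_operator :: "'a::complex_inner \<rightharpoonup> 'a" where
  "zero_operator = (\<lambda>_. Some 0)"

end

theory Submission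
  imports Defs
begin

text \<open>
  The operators are prescribed on a linearly independent sequence \<open>b 0, b 1, \<dots>\<close>, taken from a
  Hamel basis. A nilpotent Jordan block \<open>b 0 \<mapsto> b 1 \<mapsto> \<dots> \<mapsto> b (n - 1) \<mapsto> 0\<close> on its first
  \<open>n\<close> members makes the index of nilpotency exactly \<open>n\<close>. Each later vector \<open>b i\<close> is sent to a
  multiple of the end \<open>b (n - 1)\<close> of the chain, and \<open>T\<close> is extended to the whole space without
  enlarging its range. Since \<open>b (n - 1)\<close> is in the kernel and \<open>n \<ge> 2\<close>, these additional values
  do not disturb the nilpotency, whatever the multiples are (\<open>jordan_block_extension\<close>).

  The multiples are free, so they can be made large: with \<open>T (b i) = c * i * norm (b i) * b (n - 1)\<close>
  the vectors \<open>b i / (i * norm (b i))\<close> tend to \<open>0\<close>, while all their images equal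
  \<open>c * b (n - 1) \<noteq> 0\<close>. Hence \<open>T\<close> is not closable, and a fortiori it is unbounded
  (\<open>not_closable_if_constant_image\<close>). Different \<open>c\<close> give different operators.
\<close>

interpretation complex_vector_pair: vector_space_pair
  "scaleC :: complex \<Rightarrow> 'a \<Rightarrow> 'a::complex_inner"
  "scaleC :: complex \<Rightarrow> 'b \<Rightarrow> 'b::complex_inner" ..

abbreviation clinear :: "('a::complex_inner \<Rightarrow> 'b::complex_inner) \<Rightarrow> bool" where
  "clinear \<equiv> Vector_Spaces.linear scaleC scaleC"

lemma infinite_dimensional_independent_sequence:
  assumes "infinite_dimensional TYPE('a::complex_inner)"
  obtains b :: "nat \<Rightarrow> 'a::complex_inner" where "inj b" "complex_vector.independent (range b)"
proof -
  obtain B :: "'a set" where B: "complex_vector.independent B" "UNIV \<subseteq> complex_vector.span B"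
    by (rule complex_vector.maximal_independent_subset[of "UNIV :: 'a set"])
  then have "infinite B"
    using assms unfolding infinite_dimensional_def by blast
  then obtain b :: "nat \<Rightarrow> 'a" where b: "inj b" "range b \<subseteq> B"
    using infinite_countable_subset by blast
  have "complex_vector.independent (range b)"
    by (rule complex_vector.independent_mono[OF B(1) b(2)])
  with b(1) that show ?thesis by blast
qed

text \<open>
  Every value of \<open>T\<close> lies in the span of \<open>b 1, \<dots>, b (n - 1)\<close>, the part of the chain that the first
  step reaches, and each further application of \<open>T\<close> shortens this tail by one vector. So
  \<open>T ^^ n\<close> vanishes on the whole space, not only on the span of the sequence. The
  hypothesis \<open>n \<ge> 2\<close> makes the end of the chain a member of the tail.
\<close>

lemma jordan_block_extension:
  fixes b :: "nat \<Rightarrow> 'a::complex_inner" and a :: "nat \<Rightarrow> complex"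
  assumes inj: "inj b" and indep: "complex_vector.independent (range b)" and n: "n \<ge> 2"
  obtains T :: "'a \<Rightarrow> 'a" where "clinear T" "T ^^ n = (\<lambda>_. 0)" "(T ^^ (n - 1)) (b 0) = b (n - 1)"
    "\<And>i. i \<ge> n \<Longrightarrow> T (b i) = a i *\<^sub>C b (n - 1)"
proof -
  define v where
    "v i = (if i < n - 1 then b (Suc i) else if i = n - 1 then 0 else a i *\<^sub>C b (n - 1))" for i
  \<comment> \<open>The equation for the range controls \<open>T\<close> outside the span of the sequence as well.\<close>
  obtain T where T: "clinear T" "\<And>x. x \<in> range b \<Longrightarrow> T x = v (inv b x)"
    and range_T: "range T = complex_vector.span ((\<lambda>x. v (inv b x)) ` range b)"
    using complex_vector_pair.linear_independent_extend_subspace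
      [OF indep, of "\<lambda>x. v (inv b x)"] by blast
  interpret T: Vector_Spaces.linear scaleC scaleC T by (rule T(1))
  have Tb: "T (b i) = v i" for i
    using T(2)[of "b i"] inj by simp
  define tail where "tail k = complex_vector.span (b ` {k..<n})" for k
  have tail_step: "T x \<in> tail (Suc k)" if "x \<in> tail k" for x k
  proof -
    have "T (b i) \<in> tail (Suc k)" if "k \<le> i" "i < n" for i
      using that unfolding Tb v_def tail_def
      by (auto intro: complex_vector.span_base complex_vector.span_zero)
    then have "T ` b ` {k..<n} \<subseteq> tail (Suc k)" by auto
    then have "complex_vector.span (T ` b ` {k..<n}) \<subseteq> tail (Suc k)"
      unfolding tail_def by (intro complex_vector.span_minimal) auto
    then show ?thesis
      using that T.span_image[of "b ` {k..<n}"] unfolding tail_def by blast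
  qed
  have "v i \<in> tail 1" for i
    using n unfolding v_def tail_def
    by (auto intro!: complex_vector.span_base complex_vector.span_zero complex_vector.span_scale)
  then have T_tail: "T x \<in> tail 1" for x
    using range_T complex_vector.span_minimal[of "(\<lambda>x. v (inv b x)) ` range b" "tail 1"]
    unfolding tail_def by blast
  have power_tail: "(T ^^ Suc k) x \<in> tail (Suc k)" for k x
    by (induction k) (use T_tail tail_step in auto)
  have "T ^^ n = (\<lambda>_. 0)"
    using power_tail[of "n - 1"] n by (auto simp: tail_def fun_eq_iff)
  moreover have "(T ^^ k) (b 0) = b k" if "k \<le> n - 1" for k
    using that by (induction k) (auto simp: Tb v_def)
  moreover have "T (b i) = a i *\<^sub>C b (n - 1)" if "i \<ge> n" for i
    using that n by (auto simp: Tb v_def)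
  ultimately show ?thesis using that T(1) by blast
qed

lemma linear_operator_Some:
  assumes "clinear T"
  shows "linear_operator (\<lambda>x. Some (T x))"
proof -
  interpret T: Vector_Spaces.linear scaleC scaleC T by (rule assms)
  have "dom (\<lambda>x. Some (T x)) = UNIV" by auto
  then show ?thesis
    by (simp add: linear_operator_def T.add T.scale)
qed

lemma operator_power_Some: "operator_power (\<lambda>x. Some (T x)) k = (\<lambda>x. Some ((T ^^ k) x))"
  by (induction k) (auto simp: map_comp_def)

lemma bounded_operator_closable:
  assumes "bounded_operator T"
  shows "closable T"
  unfolding closable_def
proof (intro allI impI)
  fix X :: "nat \<Rightarrow> 'a" and y
  assume X: "\<forall>k. X k \<in> dom T" "X \<longlonglongrightarrow> 0" and lim: "(\<lambda>k. the (T (X k))) \<longlonglongrightarrow> y"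
  obtain M where M: "\<forall>x\<in>dom T. norm (the (T x)) \<le> M * norm x"
    using assms unfolding bounded_operator_def by blast
  have "(\<lambda>k. M * norm (X k)) \<longlonglongrightarrow> 0"
    using tendsto_mult_left[OF tendsto_norm[OF X(2)], of M] by simp
  then have "(\<lambda>k. the (T (X k))) \<longlonglongrightarrow> 0"
    by (rule Lim_null_comparison[rotated]) (use M X(1) in auto)
  then show "y = 0" using lim LIMSEQ_unique by blast
qed

lemma not_closable_if_constant_image:
  assumes "X \<longlonglongrightarrow> 0" "\<And>k::nat. T (X k) = y" "y \<noteq> 0"
  shows "\<not> closable (\<lambda>x. Some (T x))"
proof
  assume "closable (\<lambda>x. Some (T x))"
  moreover have "(\<lambda>k. the (Some (T (X k)))) \<longlonglongrightarrow> y" using assms(2) by simp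
  moreover have "\<forall>k. X k \<in> dom (\<lambda>x. Some (T x))" by auto
  ultimately have "y = 0" using assms(1) unfolding closable_def by blast
  with assms(3) show False by contradiction
qed

theorem theorem1p5:
  fixes n :: nat
  assumes "n \<ge> 2"
    and "infinite_dimensional TYPE('a::chilbert_space)"
  shows "infinite {T :: 'a \<rightharpoonup> 'a.
           linear_operator T \<and> everywhere_defined T \<and>
           \<not> closable T \<and> \<not> bounded_operator T \<and>
           operator_power T n = zero_operator \<and>
           operator_power T (n - 1) \<noteq> zero_operator}"
    (is "infinite ?S")
proof -
  obtain b :: "nat \<Rightarrow> 'a" where b: "inj b" "complex_vector.independent (range b)"
    using infinite_dimensional_independent_sequence[OF assms(2)] by blast
  have b_nz: "b i \<noteq> 0" for i
    using b(2) complex_vector.dependent_zero by (metis rangeI)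
  \<comment> \<open>\<open>Suc m\<close> is the nonzero parameter that tells the operators apart.\<close>
  define a where "a m i = complex_of_real (real (Suc m) * (real i * norm (b i)))" for m i
  have "\<forall>m. \<exists>T. clinear T \<and> T ^^ n = (\<lambda>_. 0) \<and> (T ^^ (n - 1)) (b 0) = b (n - 1) \<and>
      (\<forall>i\<ge>n. T (b i) = a m i *\<^sub>C b (n - 1))"
    using jordan_block_extension[OF b assms(1)] by metis
  from choice[OF this] obtain T where "\<forall>m. clinear (T m) \<and> T m ^^ n = (\<lambda>_. 0) \<and>
      (T m ^^ (n - 1)) (b 0) = b (n - 1) \<and> (\<forall>i\<ge>n. T m (b i) = a m i *\<^sub>C b (n - 1))" ..
  then have T: "\<And>m. clinear (T m)" "\<And>m. T m ^^ n = (\<lambda>_. 0)"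
    "\<And>m. (T m ^^ (n - 1)) (b 0) = b (n - 1)"
    "\<And>m i. i \<ge> n \<Longrightarrow> T m (b i) = a m i *\<^sub>C b (n - 1)"
    by simp_all
  \<comment> \<open>The indices start at \<open>n\<close>: the first \<open>n\<close> vectors carry the Jordan block.\<close>
  define X where "X k = (1 / (real (k + n) * norm (b (k + n)))) *\<^sub>R b (k + n)" for k
  have "(\<lambda>k. inverse (real (k + n))) \<longlonglongrightarrow> 0"
    by (rule LIMSEQ_ignore_initial_segment[OF lim_inverse_n])
  moreover have "norm (X k) = inverse (real (k + n))" for k
    by (simp add: X_def b_nz inverse_eq_divide del: of_nat_add)
  ultimately have X_lim: "X \<longlonglongrightarrow> 0"
    by (simp add: tendsto_norm_zero_cancel)
  have TX: "T m (X k) = of_nat (Suc m) *\<^sub>C b (n - 1)" for m k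
  proof -
    interpret Tm: Vector_Spaces.linear scaleC scaleC "T m" by (rule T(1))
    have "T m (X k) =
        (complex_of_real (1 / (real (k + n) * norm (b (k + n)))) * a m (k + n)) *\<^sub>C b (n - 1)"
      by (simp only: X_def scaleR_scaleC Tm.scale T(4) le_add2 scaleC_scaleC)
    also have "complex_of_real (1 / (real (k + n) * norm (b (k + n)))) * a m (k + n) =
        complex_of_real (real (Suc m))"
      unfolding a_def of_real_mult[symmetric] of_real_eq_iff
      using assms(1) by (simp add: b_nz del: of_nat_add of_nat_Suc)
    finally show ?thesis by simp
  qed
  define P where "P m = (\<lambda>x. Some (T m x))" for m
  have "P m \<in> ?S" for m
  proof -
    have "of_nat (Suc m) *\<^sub>C b (n - 1) \<noteq> 0"
      using b_nz by (simp del: of_nat_Suc)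
    then have nc: "\<not> closable (P m)"
      unfolding P_def using not_closable_if_constant_image[where T = "T m", OF X_lim TX] by blast
    have "(T m ^^ (n - 1)) (b 0) \<noteq> 0" using T(3) b_nz by simp
    then have "operator_power (P m) (n - 1) \<noteq> zero_operator"
      by (auto simp: P_def operator_power_Some zero_operator_def fun_eq_iff)
    moreover have "linear_operator (P m)"
      unfolding P_def by (rule linear_operator_Some[OF T(1)])
    moreover have "everywhere_defined (P m)"
      by (auto simp: P_def everywhere_defined_def)
    moreover have "operator_power (P m) n = zero_operator"
      by (simp add: P_def operator_power_Some zero_operator_def T(2))
    moreover have "\<not> bounded_operator (P m)"
      using nc bounded_operator_closable by blast
    ultimately show ?thesis using nc by simp
  qed
  then have P_sub: "range P \<subseteq> ?S" by (rule image_subsetI)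
  have "inj P"
  proof (rule injI)
    fix m m' assume "P m = P m'"
    then have "T m (X 0) = T m' (X 0)" by (simp add: P_def fun_eq_iff)
    then have "(of_nat (Suc m) :: complex) = of_nat (Suc m')"
      using b_nz by (simp add: TX del: of_nat_Suc)
    then show "m = m'" by (simp only: of_nat_eq_iff nat.inject)
  qed
  then show ?thesis
    by (rule infinite_super[OF P_sub range_inj_infinite])
qed

end
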